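(* Let $\mathcal{G}$ be a simplicial graph with vertex set $I$, let $\{E_i\}_{i\in I}$ be rank-one buildings, let $\{G_i\}_{i\in I}$ be groups with $G_i$ acting on $E_i$, let $\widetilde{E}=\prod_{\mathcal{G}}E_i$, and let $C_0$ be a chamber of $\widetilde{E}$. For $n\ge 0$ let $D_n$ be the set of chambers $C$ of $\widetilde{E}$ with $\ell(\delta(C,C_0))<n$. Then $$\mathrm{Stab}_{\mathrm{Aut}_{\mathrm{sp}}(\widetilde{E})}(C_0)=\varprojlim_n \mathrm{Aut}_{\mathrm{sp}}(D_n),$$ where the inverse limit is taken along the restriction homomorphisms $\mathrm{Aut}_{\mathrm{sp}}(D_{n+1})\to\mathrm{Aut}_{\mathrm{sp}}(D_n)$.
   Context: Buildings are in the $W$-metric sense (chambers with a distance $\delta$ valued in a Coxeter group; $\ell$ is word length). A rank-one building is a set (of at least two chambers) with $\delta(C,C')=s$, the generator of $\mathbb{Z}_2$, whenever $C\neq C'$. Let $W$ be the right-angled Coxeter group with generating set $I$, where $i\ne j$ commute iff $\{i,j\}$ is an edge of $\mathcal{G}$, and $m(i,j)=\infty$ otherwise. Definition of $\widetilde{E}$. $E=\prod_i E_i$ is a building of type $\prod_i\mathbb{Z}_2$ with componentwise distance. Let $K'$ be the Davis chamber of $(W,I)$: the geometric realization of the poset of spherical subsets of $I$ (subsets $T$, including $\emptyset$, generating a finite subgroup of $W$), with mirrors $K'_i$ = realization of the subposet of spherical subsets containing $i$. Let $\mathcal{U}(E,K')=(E\times K')/\!\sim$, where $(C,x)\sim(D,y)$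 iff $x=y$ and $\delta(C,D)$ lies in the subgroup generated by $\{i: x\in K'_i\}$. The graph product $\widetilde{E}=\prod_{\mathcal{G}}E_i$ is the set of copies of $K'$ in the universal cover of $\mathcal{U}(E,K')$, two distinct copies being $i$-adjacent if they share their $i$-mirror; it is a right-angled building of type $(W,I)$. Let $p:\widetilde{E}\to E$ be induced by the covering map and $p_i:\widetilde{E}\to E_i$ be $p$ followed by projection. An $i$-panel is an equivalence class of chambers under "equal or $i$-adjacent". An automorphism of $\widetilde{E}$ (always type preserving: it sends $i$-panels to $i$-panels for every $i$) is structure preserving if for each $i\in I$ and each $i$-panel $\mathcal{R}$ there is $g_i\in G_i$ with $p_i(g(C))=g_i\cdot p_i(C)$ for all $C\in\mathcal{R}$. The group of these is $\mathrm{Aut}_{\mathrm{sp}}(\widetilde{E})$. A structure preserving automorphism of $D_n$ is a bijection $g:D_n\to D_n$ fixing $C_0$ (if $n\geq1$), preserving $i$-adjacency in both directions for every $i\in I$, such that for each $i$ and each $i$-panel $\mathcal{R}$ with $\mathcal{R}\cap D_n\neq\emptyset$ there is $g_i\in G_i$ with $p_i(g(C))=g_i\cdot p_i(C)$ for all $C\in\mathcal{R}\cap D_n$. The group of these is $\mathrm{Aut}_{\mathrm{sp}}(D_n)$ (trivial for $n=0$). Equality of groups means isomorphism via restriction to the $D_n$. The index set $I$ is finite. *)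

theory Defs
  imports
    "HOL-Analysis.Analysis"
    "HOL-Algebra.Group_Action"
    "HOL-Algebra.Generated_Groups"
    "HOL-Algebra.Elementary_Groups"
    "HOL-Algebra.Product_Groups"
begin

section \<open>Coxeter groups by generators and relations\<close>

text \<open>
  A Coxeter matrix is a function \<open>m\<close> with the entry \<open>0\<close> standing for \<open>\<infinity>\<close>. The relator belonging to
  \<open>i, j\<close> is the word \<open>(i j)\<^sup>m\<close>, which is empty for the entry \<open>0\<close>. Since \<open>m i i = 1\<close> gives the relator
  \<open>i i\<close>, the monoid presented here is already the Coxeter group, and no formal inverses are needed.
\<close>

inductive coxeter_eq :: "'i set \<Rightarrow> ('i \<Rightarrow> 'i \<Rightarrow> nat) \<Rightarrow> 'i list \<Rightarrow> 'i list \<Rightarrow> bool"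
  for I :: "'i set" and m :: "'i \<Rightarrow> 'i \<Rightarrow> nat"
where
  relator: "\<lbrakk>u \<in> lists I; v \<in> lists I; i \<in> I; j \<in> I\<rbrakk>
     \<Longrightarrow> coxeter_eq I m (u @ concat (replicate (m i j) [i, j]) @ v) (u @ v)"
| refl: "u \<in> lists I \<Longrightarrow> coxeter_eq I m u u"
| sym: "coxeter_eq I m u v \<Longrightarrow> coxeter_eq I m v u"
| trans: "\<lbrakk>coxeter_eq I m u v; coxeter_eq I m v w\<rbrakk> \<Longrightarrow> coxeter_eq I m u w"

definition coxeter_rel :: "'i set \<Rightarrow> ('i \<Rightarrow> 'i \<Rightarrow> nat) \<Rightarrow> ('i list \<times> 'i list) set" where
  "coxeter_rel I m = {(u, v). coxeter_eq I m u v}"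

text \<open>The element of the Coxeter group represented by a word.\<close>

definition word_class :: "'i set \<Rightarrow> ('i \<Rightarrow> 'i \<Rightarrow> nat) \<Rightarrow> 'i list \<Rightarrow> 'i list set" where
  "word_class I m u = coxeter_rel I m `` {u}"

definition coxeter_group :: "'i set \<Rightarrow> ('i \<Rightarrow> 'i \<Rightarrow> nat) \<Rightarrow> 'i list set monoid" where
  "coxeter_group I m =
     \<lparr>carrier = lists I // coxeter_rel I m,
      monoid.mult = (\<lambda>a b. \<Union>u\<in>a. \<Union>v\<in>b. word_class I m (u @ v)),
      one = word_class I m []\<rparr>"

text \<open>Word length: group elements are sets of words, and \<open>u \<in> w\<close> says that \<open>u\<close> represents \<open>w\<close>.\<close>

definition word_length :: "'i list set \<Rightarrow> nat" where
  "word_length w = (LEAST n. \<exists>u\<in>w. length u = n)"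

definition simplicial_graph :: "'i set \<Rightarrow> 'i set set \<Rightarrow> bool" where
  "simplicial_graph I Edges \<longleftrightarrow> (\<forall>e\<in>Edges. e \<subseteq> I \<and> card e = 2)"

definition right_angled_matrix :: "'i set set \<Rightarrow> 'i \<Rightarrow> 'i \<Rightarrow> nat" where
  "right_angled_matrix Edges i j = (if i = j then 1 else if {i, j} \<in> Edges then 2 else 0)"

abbreviation racg :: "'i set \<Rightarrow> 'i set set \<Rightarrow> 'i list set monoid" where
  "racg I Edges \<equiv> coxeter_group I (right_angled_matrix Edges)"

lemma coxeter_eq_lists:
  assumes "coxeter_eq I m u v"
  shows "u \<in> lists I \<and> v \<in> lists I"
  using assms
proof (induction rule: coxeter_eq.induct)
  case (relator u v i j)
  have "concat (replicate n [i, j]) \<in> lists I" for n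
    using relator by (induction n) auto
  then show ?case using relator by auto
qed auto

lemma coxeter_eq_append:
  assumes "coxeter_eq I m u v" "a \<in> lists I" "b \<in> lists I"
  shows "coxeter_eq I m (a @ u @ b) (a @ v @ b)"
  using assms
proof (induction rule: coxeter_eq.induct)
  case (relator u v i j)
  then show ?case
    using coxeter_eq.relator[of "a @ u" I "v @ b" i j m] by auto
next
  case (refl u)
  then show ?case by (intro coxeter_eq.refl) auto
next
  case (sym u v)
  then show ?case by (metis coxeter_eq.sym)
next
  case (trans u v w)
  then show ?case by (metis coxeter_eq.trans)
qed

lemma coxeter_eq_append2:
  assumes "coxeter_eq I m u u'" "coxeter_eq I m v v'"
  shows "coxeter_eq I m (u @ v) (u' @ v')"
proof -
  have "coxeter_eq I m (u @ v) (u' @ v)"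
    using coxeter_eq_append[of I m u u' "[]" v] assms coxeter_eq_lists[of I m] by auto
  moreover have "coxeter_eq I m (u' @ v) (u' @ v')"
    using coxeter_eq_append[of I m v v' u' "[]"] assms coxeter_eq_lists[of I m] by auto
  ultimately show ?thesis by (rule coxeter_eq.trans)
qed

lemma equiv_coxeter_rel: "equiv (lists I) (coxeter_rel I m)"
proof (rule equivI)
  show "coxeter_rel I m \<subseteq> lists I \<times> lists I"
    unfolding coxeter_rel_def using coxeter_eq_lists[of I m] by blast
  show "refl_on (lists I) (coxeter_rel I m)"
    unfolding coxeter_rel_def refl_on_def using coxeter_eq.refl[of _ I m] by blast
  show "sym (coxeter_rel I m)"
    unfolding coxeter_rel_def sym_def using coxeter_eq.sym[of I m] by blast
  show "trans (coxeter_rel I m)"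
    unfolding coxeter_rel_def trans_def using coxeter_eq.trans[of I m] by blast
qed

lemma word_class_eq_iff:
  assumes "u \<in> lists I" "v \<in> lists I"
  shows "word_class I m u = word_class I m v \<longleftrightarrow> coxeter_eq I m u v"
  unfolding word_class_def
  using eq_equiv_class_iff[OF equiv_coxeter_rel[of I m] assms] by (simp add: coxeter_rel_def)

lemma carrier_coxeter_group: "carrier (coxeter_group I m) = word_class I m ` lists I"
  by (auto simp: coxeter_group_def quotient_def word_class_def)

lemma word_class_mult:
  assumes "u \<in> lists I" "v \<in> lists I"
  shows "word_class I m u \<otimes>\<^bsub>coxeter_group I m\<^esub> word_class I m v = word_class I m (u @ v)"
proof -
  have "word_class I m (u' @ v') = word_class I m (u @ v)"
    if "u' \<in> word_class I m u" "v' \<in> word_class I m v" for u' v'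
  proof -
    have "coxeter_eq I m u u'" "coxeter_eq I m v v'"
      using that by (auto simp: word_class_def coxeter_rel_def)
    then have "coxeter_eq I m (u @ v) (u' @ v')" by (rule coxeter_eq_append2)
    then show ?thesis
      by (metis word_class_eq_iff coxeter_eq_lists)
  qed
  moreover have "u \<in> word_class I m u" "v \<in> word_class I m v"
    using coxeter_eq.refl[OF assms(1)] coxeter_eq.refl[OF assms(2)]
    by (simp_all add: word_class_def coxeter_rel_def)
  ultimately have "(\<Union>u'\<in>word_class I m u. \<Union>v'\<in>word_class I m v. word_class I m (u' @ v'))
      = word_class I m (u @ v)"
    by fast
  then show ?thesis by (simp add: coxeter_group_def)
qed

lemma group_coxeter_group:
  assumes "\<And>i. i \<in> I \<Longrightarrow> m i i = 1"
  shows "group (coxeter_group I m)"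
proof -
  let ?W = "coxeter_group I m" and ?c = "word_class I m"
  have one: "\<one>\<^bsub>?W\<^esub> = ?c []" by (simp add: coxeter_group_def)
  have nil: "[] \<in> lists I" by simp
  have rep: "\<exists>u\<in>lists I. x = ?c u" if "x \<in> carrier ?W" for x
    using that unfolding carrier_coxeter_group by blast
  have cl: "?c u \<in> carrier ?W" if "u \<in> lists I" for u
    using that unfolding carrier_coxeter_group by blast
  have app: "u @ v \<in> lists I" if "u \<in> lists I" "v \<in> lists I" for u v
    using that by simp
  have inv: "?c (rev u) \<otimes>\<^bsub>?W\<^esub> ?c u = \<one>\<^bsub>?W\<^esub>" if "u \<in> lists I" for u
  proof -
    have "coxeter_eq I m (rev u @ u) []"
      using that
    proof (induction u)
      case Nil
      then show ?case by (simp add: coxeter_eq.refl)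
    next
      case (Cons i u)
      then have "coxeter_eq I m (rev u @ concat (replicate (m i i) [i, i]) @ u) (rev u @ u)"
        by (intro coxeter_eq.relator) auto
      then have "coxeter_eq I m (rev (i # u) @ i # u) (rev u @ u)"
        using Cons.hyps assms[of i] by simp
      with Cons.IH show ?case by (rule coxeter_eq.trans[rotated])
    qed
    moreover have r: "rev u \<in> lists I" using that by auto
    ultimately show ?thesis
      using word_class_eq_iff[OF app[OF r that] nil] by (simp only: word_class_mult[OF r that] one)
  qed
  show ?thesis
  proof (rule groupI)
    show "x \<otimes>\<^bsub>?W\<^esub> y \<in> carrier ?W" if "x \<in> carrier ?W" "y \<in> carrier ?W" for x y
      by (metis rep[OF that(1)] rep[OF that(2)] word_class_mult cl app)
    show "\<one>\<^bsub>?W\<^esub> \<in> carrier ?W"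
      using cl[OF nil] by (simp only: one)
    show "x \<otimes>\<^bsub>?W\<^esub> y \<otimes>\<^bsub>?W\<^esub> z = x \<otimes>\<^bsub>?W\<^esub> (y \<otimes>\<^bsub>?W\<^esub> z)"
      if "x \<in> carrier ?W" "y \<in> carrier ?W" "z \<in> carrier ?W" for x y z
      by (metis rep[OF that(1)] rep[OF that(2)] rep[OF that(3)] word_class_mult app append_assoc)
    show "\<one>\<^bsub>?W\<^esub> \<otimes>\<^bsub>?W\<^esub> x = x" if "x \<in> carrier ?W" for x
      by (metis rep[OF that] one word_class_mult nil append_Nil)
    show "\<exists>y\<in>carrier ?W. y \<otimes>\<^bsub>?W\<^esub> x = \<one>\<^bsub>?W\<^esub>" if x: "x \<in> carrier ?W" for x
    proof -
      obtain u where u: "u \<in> lists I" "x = ?c u" using rep[OF x] by blast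
      moreover have "rev u \<in> lists I" using u(1) by auto
      ultimately show ?thesis using inv[OF u(1)] cl by blast
    qed
  qed
qed

section \<open>Rank-one buildings and their product\<close>

text \<open>
  A rank-one building is determined by its set of chambers; its distance has values in \<open>\<int>/2\<close>, with
  generator \<open>1\<close>.
\<close>

definition rank_one_building :: "'e set \<Rightarrow> bool" where
  "rank_one_building S \<longleftrightarrow> (\<exists>x\<in>S. \<exists>y\<in>S. x \<noteq> y)"

definition rank_one_dist :: "'e \<Rightarrow> 'e \<Rightarrow> int" where
  "rank_one_dist x y = (if x = y then 0 else 1)"

abbreviation prod_Z2 :: "'i set \<Rightarrow> ('i \<Rightarrow> int) monoid" where
  "prod_Z2 I \<equiv> product_group I (\<lambda>i. integer_mod_group 2)"

definition prod_Z2_gen :: "'i set \<Rightarrow> 'i \<Rightarrow> 'i \<Rightarrow> int" where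
  "prod_Z2_gen I i = (\<lambda>j\<in>I. if j = i then 1 else 0)"

abbreviation (input) prod_chambers :: "'i set \<Rightarrow> ('i \<Rightarrow> 'e set) \<Rightarrow> ('i \<Rightarrow> 'e) set" where
  "prod_chambers I Es \<equiv> (\<Pi>\<^sub>E i\<in>I. Es i)"

definition prod_dist :: "'i set \<Rightarrow> ('i \<Rightarrow> 'e) \<Rightarrow> ('i \<Rightarrow> 'e) \<Rightarrow> ('i \<Rightarrow> int)" where
  "prod_dist I C D = (\<lambda>i\<in>I. rank_one_dist (C i) (D i))"

lemma generate_prod_Z2_gen:
  assumes "finite I" "J \<subseteq> I"
  shows "generate (prod_Z2 I) (prod_Z2_gen I ` J) =
    {z \<in> (\<Pi>\<^sub>E i\<in>I. {0, 1}). \<forall>i\<in>I - J. z i = 0}" (is "?L = ?R")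
proof
  have car: "carrier (prod_Z2 I) = (\<Pi>\<^sub>E i\<in>I. {0, 1})"
    by (simp add: carrier_integer_mod_group) (rule PiE_cong, auto)
  have mult: "x \<otimes>\<^bsub>prod_Z2 I\<^esub> y = (\<lambda>i\<in>I. (x i + y i) mod 2)" for x y
    by (simp add: integer_mod_group_def)
  have unit: "\<one>\<^bsub>prod_Z2 I\<^esub> = (\<lambda>i\<in>I. 0)"
    by (simp add: integer_mod_group_def)
  interpret P: group "prod_Z2 I"
    by (rule product_group) simp
  have gen: "prod_Z2_gen I j \<in> (\<Pi>\<^sub>E i\<in>I. {0, 1})" for j
    by (auto simp: prod_Z2_gen_def)
  show "?L \<subseteq> ?R"
  proof
    fix z assume "z \<in> ?L"
    then show "z \<in> ?R"
    proof (induction rule: generate.induct)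
      case one
      then show ?case by (subst unit) auto
    next
      case (incl h)
      then show ?case using gen by (auto simp: prod_Z2_gen_def split: if_splits)
    next
      case (inv h)
      then obtain j where j: "j \<in> J" "h = prod_Z2_gen I j" by blast
      have "h \<otimes>\<^bsub>prod_Z2 I\<^esub> h = \<one>\<^bsub>prod_Z2 I\<^esub>"
        unfolding mult unit j by (rule ext) (simp add: prod_Z2_gen_def)
      then have "inv\<^bsub>prod_Z2 I\<^esub> h = h"
        using P.inv_equality[of h h] gen[of j] j car by simp
      then show ?case using gen j by (auto simp: prod_Z2_gen_def split: if_splits)
    next
      case (eng h1 h2)
      then show ?case unfolding mult by auto
    qed
  qed
  have "\<forall>z \<in> (\<Pi>\<^sub>E i\<in>I. {0, 1}). {i \<in> I. z i \<noteq> 0} \<subseteq> K \<longrightarrow> z \<in> ?L" if "finite K" "K \<subseteq> J" for K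
    using that
  proof (induction K)
    case empty
    have "z = \<one>\<^bsub>prod_Z2 I\<^esub>" if "z \<in> (\<Pi>\<^sub>E i\<in>I. {0, 1})" "{i \<in> I. z i \<noteq> 0} \<subseteq> {}" for z
    proof
      show "z i = \<one>\<^bsub>prod_Z2 I\<^esub> i" for i
        using that(2) PiE_arb[OF that(1), of i] unfolding unit by (cases "i \<in> I") auto
    qed
    then show ?case
      using generate.one[of "prod_Z2 I" "prod_Z2_gen I ` J"] by (intro ballI impI) simp
  next
    case (insert j K)
    show ?case
    proof (intro ballI impI)
      fix z :: "'a \<Rightarrow> int"
      assume z: "z \<in> (\<Pi>\<^sub>E i\<in>I. {0, 1})" "{i \<in> I. z i \<noteq> 0} \<subseteq> insert j K"
      show "z \<in> ?L"
      proof (cases "z j = 0")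
        case True
        then have "{i \<in> I. z i \<noteq> 0} \<subseteq> K" using z(2) by auto
        then show ?thesis using insert z by blast
      next
        case False
        have j: "j \<in> I" "j \<in> J" using insert assms by auto
        have zj: "z j = 1" using PiE_mem[OF z(1) j(1)] False by auto
        have "z(j := 0) \<in> (\<Pi>\<^sub>E i\<in>I. {0, 1})" using z(1) j by (auto simp: PiE_iff extensional_def)
        moreover have "{i \<in> I. (z(j := 0)) i \<noteq> 0} \<subseteq> K" using z(2) by auto
        ultimately have "z(j := 0) \<in> ?L" using insert by blast
        moreover have "prod_Z2_gen I j \<in> ?L" using j by (intro generate.incl) blast
        moreover have "prod_Z2_gen I j \<otimes>\<^bsub>prod_Z2 I\<^esub> z(j := 0) = z"
        proof
          fix i
          have "z i mod 2 = z i" if "i \<in> I" using PiE_mem[OF z(1) that] by auto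
          moreover have "z i = undefined" if "i \<notin> I" using z(1) that by auto
          ultimately show "(prod_Z2_gen I j \<otimes>\<^bsub>prod_Z2 I\<^esub> z(j := 0)) i = z i"
            unfolding mult using j zj by (simp add: prod_Z2_gen_def)
        qed
        ultimately show ?thesis by (metis generate.eng)
      qed
    qed
  qed
  from this[of J] show "?R \<subseteq> ?L"
    using assms finite_subset by blast
qed

lemma prod_dist_in_generate_iff:
  assumes "finite I" "J \<subseteq> I"
  shows "prod_dist I C D \<in> generate (prod_Z2 I) (prod_Z2_gen I ` J) \<longleftrightarrow> (\<forall>i\<in>I - J. C i = D i)"
  unfolding generate_prod_Z2_gen[OF assms]
  by (auto simp: prod_dist_def rank_one_dist_def)

section \<open>The Davis chamber\<close>

definition spherical_subsets :: "'i set \<Rightarrow> 'i set set \<Rightarrow> 'i set set" where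
  "spherical_subsets I Edges =
     {T. T \<subseteq> I \<and>
         finite (generate (racg I Edges) ((\<lambda>i. word_class I (right_angled_matrix Edges) [i]) ` T))}"

text \<open>
  Geometric realization of a set \<open>P\<close> of sets, ordered by inclusion, in barycentric coordinates: the
  support of a point is a finite chain of \<open>P\<close>. Only finite \<open>P\<close> occur below, for which the topology
  inherited from the product topology on \<open>'i set \<Rightarrow> real\<close> is the usual one.
\<close>

definition realization :: "'i set set \<Rightarrow> ('i set \<Rightarrow> real) set" where
  "realization P =
     {x. (\<forall>T. 0 \<le> x T) \<and> finite {T. x T \<noteq> 0} \<and> {T. x T \<noteq> 0} \<subseteq> P \<and>
         (\<forall>S T. x S \<noteq> 0 \<longrightarrow> x T \<noteq> 0 \<longrightarrow> S \<subseteq> T \<or> T \<subseteq> S) \<and> (\<Sum>T | x T \<noteq> 0. x T) = 1}"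

definition davis_chamber :: "'i set \<Rightarrow> 'i set set \<Rightarrow> ('i set \<Rightarrow> real) set" where
  "davis_chamber I Edges = realization (spherical_subsets I Edges)"

definition davis_mirror :: "'i set \<Rightarrow> 'i set set \<Rightarrow> 'i \<Rightarrow> ('i set \<Rightarrow> real) set" where
  "davis_mirror I Edges i = realization {T \<in> spherical_subsets I Edges. i \<in> T}"

section \<open>The space \<open>\<U>(E, K')\<close>\<close>

definition quotient_topology :: "'a topology \<Rightarrow> ('a \<times> 'a) set \<Rightarrow> 'a set topology" where
  "quotient_topology X r = topology (\<lambda>V. V \<subseteq> topspace X // r \<and> openin X (\<Union>V))"

lemma openin_quotient_topology:
  assumes "equiv (topspace X) r"
  shows "openin (quotient_topology X r) V \<longleftrightarrow> V \<subseteq> topspace X // r \<and> openin X (\<Union>V)"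
proof -
  have "istopology (\<lambda>V. V \<subseteq> topspace X // r \<and> openin X (\<Union>V))"
    unfolding istopology_def
  proof (intro conjI allI impI)
    fix S T
    assume S: "S \<subseteq> topspace X // r \<and> openin X (\<Union>S)" and T: "T \<subseteq> topspace X // r \<and> openin X (\<Union>T)"
    have "\<Union>(S \<inter> T) = \<Union>S \<inter> \<Union>T"
    proof
      show "\<Union>S \<inter> \<Union>T \<subseteq> \<Union>(S \<inter> T)"
      proof
        fix x assume "x \<in> \<Union>S \<inter> \<Union>T"
        then obtain a b where "a \<in> S" "x \<in> a" "b \<in> T" "x \<in> b" by blast
        moreover from this have "a = b"
          using quotient_disj[OF assms, of a b] S T by blast
        ultimately show "x \<in> \<Union>(S \<inter> T)" by blast
      qed
    qed blast
    then show "openin X (\<Union>(S \<inter> T))" using S T by auto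
  next
    fix \<K> assume K: "\<forall>V\<in>\<K>. V \<subseteq> topspace X // r \<and> openin X (\<Union>V)"
    have "\<Union>(\<Union>\<K>) = \<Union>(Union ` \<K>)" by blast
    then show "openin X (\<Union>(\<Union>\<K>))" using K by auto
    show "\<Union>\<K> \<subseteq> topspace X // r" using K by blast
  qed blast
  then show ?thesis by (simp add: quotient_topology_def topology_inverse')
qed

definition U_rel ::
  "'i set \<Rightarrow> 'i set set \<Rightarrow> ('i \<Rightarrow> 'e set)
    \<Rightarrow> ((('i \<Rightarrow> 'e) \<times> ('i set \<Rightarrow> real)) \<times> (('i \<Rightarrow> 'e) \<times> ('i set \<Rightarrow> real))) set"
where
  "U_rel I Edges Es =
     {((C, x), (D, y)).
        C \<in> prod_chambers I Es \<and> D \<in> prod_chambers I Es \<and> x \<in> davis_chamber I Edges \<and> x = y \<and>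
        prod_dist I C D \<in>
          generate (prod_Z2 I) (prod_Z2_gen I ` {i \<in> I. x \<in> davis_mirror I Edges i})}"

lemma equiv_U_rel:
  assumes "finite I"
  shows "equiv (prod_chambers I Es \<times> davis_chamber I Edges) (U_rel I Edges Es)"
proof -
  have *: "prod_dist I C D \<in>
        generate (prod_Z2 I) (prod_Z2_gen I ` {i \<in> I. x \<in> davis_mirror I Edges i}) \<longleftrightarrow>
      (\<forall>i\<in>I. x \<notin> davis_mirror I Edges i \<longrightarrow> C i = D i)" for C D :: "'a \<Rightarrow> 'b" and x
    by (subst prod_dist_in_generate_iff) (use assms in auto)
  show ?thesis
    unfolding U_rel_def *
    by (intro equivI refl_onI symI transI) auto
qed

definition U_space ::
  "'i set \<Rightarrow> 'i set set \<Rightarrow> ('i \<Rightarrow> 'e set) \<Rightarrow> (('i \<Rightarrow> 'e) \<times> ('i set \<Rightarrow> real)) set topology"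
where
  "U_space I Edges Es =
     quotient_topology
       (prod_topology (discrete_topology (prod_chambers I Es)) (top_of_set (davis_chamber I Edges)))
       (U_rel I Edges Es)"

text \<open>The image in \<open>\<U>(E, K')\<close> of the point \<open>x\<close> of the copy \<open>C \<times> K'\<close>.\<close>

definition U_point ::
  "'i set \<Rightarrow> 'i set set \<Rightarrow> ('i \<Rightarrow> 'e set) \<Rightarrow> ('i \<Rightarrow> 'e) \<Rightarrow> ('i set \<Rightarrow> real)
    \<Rightarrow> (('i \<Rightarrow> 'e) \<times> ('i set \<Rightarrow> real)) set"
where
  "U_point I Edges Es C x = U_rel I Edges Es `` {(C, x)}"

section \<open>Universal covers\<close>

text \<open>
  \<open>covering_space\<close> and \<open>simply_connected\<close> for abstract topologies: the library has them only
  for subsets of types in class \<open>topological_space\<close>, whereas \<open>\<U>(E, K')\<close> is a quotient space.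
\<close>

definition covering_map :: "'a topology \<Rightarrow> ('a \<Rightarrow> 'b) \<Rightarrow> 'b topology \<Rightarrow> bool" where
  "covering_map X q Y \<longleftrightarrow>
     continuous_map X Y q \<and> q ` topspace X = topspace Y \<and>
     (\<forall>y\<in>topspace Y. \<exists>T. y \<in> T \<and> openin Y T \<and>
        (\<exists>\<V>. \<Union>\<V> = {x \<in> topspace X. q x \<in> T} \<and> (\<forall>V\<in>\<V>. openin X V) \<and> pairwise disjnt \<V> \<and>
             (\<forall>V\<in>\<V>. homeomorphic_map (subtopology X V) (subtopology Y T) q)))"

definition simply_connected_space :: "'a topology \<Rightarrow> bool" where
  "simply_connected_space X \<longleftrightarrow>
     (\<forall>c d. pathin X c \<and> c 1 = c 0 \<and> pathin X d \<and> d 1 = d 0 \<longrightarrow>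
        homotopic_with (\<lambda>r. r 1 = r 0) (top_of_set {0..1}) X c d)"

definition universal_cover :: "'a topology \<Rightarrow> ('a \<Rightarrow> 'b) \<Rightarrow> 'b topology \<Rightarrow> bool" where
  "universal_cover X q Y \<longleftrightarrow> covering_map X q Y \<and> simply_connected_space X"

section \<open>The graph product\<close>

text \<open>
  Below, \<open>q\<close> is a universal covering map from \<open>X\<close> onto \<open>U_space I Edges Es\<close>. A copy of \<open>K'\<close> in \<open>X\<close> is
  the image of a lift to \<open>X\<close> of one of the maps \<open>x \<mapsto> U_point I Edges Es C x\<close>.
\<close>

definition gp_chambers ::
  "'i set \<Rightarrow> 'i set set \<Rightarrow> ('i \<Rightarrow> 'e set) \<Rightarrow> 'x topology
    \<Rightarrow> ('x \<Rightarrow> (('i \<Rightarrow> 'e) \<times> ('i set \<Rightarrow> real)) set) \<Rightarrow> 'x set set"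
where
  "gp_chambers I Edges Es X q =
     {\<sigma> ` davis_chamber I Edges | \<sigma> C.
        C \<in> prod_chambers I Es \<and> continuous_map (top_of_set (davis_chamber I Edges)) X \<sigma> \<and>
        (\<forall>x\<in>davis_chamber I Edges. q (\<sigma> x) = U_point I Edges Es C x)}"

definition gp_proj ::
  "'i set \<Rightarrow> 'i set set \<Rightarrow> ('i \<Rightarrow> 'e set)
    \<Rightarrow> ('x \<Rightarrow> (('i \<Rightarrow> 'e) \<times> ('i set \<Rightarrow> real)) set) \<Rightarrow> 'x set \<Rightarrow> ('i \<Rightarrow> 'e)"
where
  "gp_proj I Edges Es q A =
     (THE C. C \<in> prod_chambers I Es \<and> q ` A = U_point I Edges Es C ` davis_chamber I Edges)"

definition gp_mirror ::
  "'i set \<Rightarrow> 'i set set \<Rightarrow> ('i \<Rightarrow> 'e set)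
    \<Rightarrow> ('x \<Rightarrow> (('i \<Rightarrow> 'e) \<times> ('i set \<Rightarrow> real)) set) \<Rightarrow> 'i \<Rightarrow> 'x set \<Rightarrow> 'x set"
where
  "gp_mirror I Edges Es q i A =
     {a \<in> A. q a \<in> U_point I Edges Es (gp_proj I Edges Es q A) ` davis_mirror I Edges i}"

definition gp_adj ::
  "'i set \<Rightarrow> 'i set set \<Rightarrow> ('i \<Rightarrow> 'e set)
    \<Rightarrow> ('x \<Rightarrow> (('i \<Rightarrow> 'e) \<times> ('i set \<Rightarrow> real)) set) \<Rightarrow> 'i \<Rightarrow> 'x set \<Rightarrow> 'x set \<Rightarrow> bool"
where
  "gp_adj I Edges Es q i A B \<longleftrightarrow>
     A \<noteq> B \<and> gp_mirror I Edges Es q i A = gp_mirror I Edges Es q i B"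

section \<open>Panels, galleries and the Weyl distance\<close>

text \<open>From here on \<open>Ch\<close> is a set of chambers and \<open>adj i\<close> the relation of \<open>i\<close>-adjacency, \<open>i \<in> I\<close>.\<close>

definition panels :: "'c set \<Rightarrow> ('i \<Rightarrow> 'c \<Rightarrow> 'c \<Rightarrow> bool) \<Rightarrow> 'i \<Rightarrow> 'c set set" where
  "panels Ch adj i = Ch // {(C, D). C \<in> Ch \<and> D \<in> Ch \<and> (C = D \<or> adj i C D)}"

fun gallery :: "'i set \<Rightarrow> 'c set \<Rightarrow> ('i \<Rightarrow> 'c \<Rightarrow> 'c \<Rightarrow> bool) \<Rightarrow> 'c \<Rightarrow> 'i list \<Rightarrow> 'c \<Rightarrow> bool" where
  "gallery I Ch adj C [] D \<longleftrightarrow> C \<in> Ch \<and> C = D"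
| "gallery I Ch adj C (i # u) D \<longleftrightarrow>
     C \<in> Ch \<and> i \<in> I \<and> (\<exists>B\<in>Ch. adj i C B \<and> gallery I Ch adj B u D)"

definition minimal_gallery ::
  "'i set \<Rightarrow> 'c set \<Rightarrow> ('i \<Rightarrow> 'c \<Rightarrow> 'c \<Rightarrow> bool) \<Rightarrow> 'c \<Rightarrow> 'i list \<Rightarrow> 'c \<Rightarrow> bool"
where
  "minimal_gallery I Ch adj C u D \<longleftrightarrow>
     gallery I Ch adj C u D \<and> (\<forall>v. gallery I Ch adj C v D \<longrightarrow> length u \<le> length v)"

text \<open>
  The Weyl distance of a building is the element represented by the type of a minimal gallery. In a
  building a minimal gallery exists and the element does not depend on it, so \<open>SOME\<close> makes no choice.
\<close>

definition weyl_dist ::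
  "'i set \<Rightarrow> ('i \<Rightarrow> 'i \<Rightarrow> nat) \<Rightarrow> 'c set \<Rightarrow> ('i \<Rightarrow> 'c \<Rightarrow> 'c \<Rightarrow> bool) \<Rightarrow> 'c \<Rightarrow> 'c \<Rightarrow> 'i list set"
where
  "weyl_dist I m Ch adj C D =
     (SOME w. \<exists>u. minimal_gallery I Ch adj C u D \<and> w = word_class I m u)"

section \<open>Structure preserving automorphisms\<close>

text \<open>
  The group \<open>G i\<close> acts on the rank-one building \<open>E\<^sub>i\<close> by \<open>act i\<close>, and \<open>p C i\<close> is the projection
  \<open>p\<^sub>i(C)\<close>.
\<close>

definition automorphisms :: "'i set \<Rightarrow> 'c set \<Rightarrow> ('i \<Rightarrow> 'c \<Rightarrow> 'c \<Rightarrow> bool) \<Rightarrow> ('c \<Rightarrow> 'c) set" where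
  "automorphisms I Ch adj =
     {g \<in> Bij Ch. \<forall>i\<in>I. \<forall>R\<in>panels Ch adj i. g ` R \<in> panels Ch adj i}"

definition Aut_sp ::
  "'i set \<Rightarrow> 'c set \<Rightarrow> ('i \<Rightarrow> 'c \<Rightarrow> 'c \<Rightarrow> bool) \<Rightarrow> ('c \<Rightarrow> 'i \<Rightarrow> 'e)
    \<Rightarrow> ('i \<Rightarrow> ('g, 'm) monoid_scheme) \<Rightarrow> ('i \<Rightarrow> 'g \<Rightarrow> 'e \<Rightarrow> 'e) \<Rightarrow> ('c \<Rightarrow> 'c) monoid"
where
  "Aut_sp I Ch adj p G act =
     (BijGroup Ch)
       \<lparr>carrier := {g \<in> automorphisms I Ch adj.
          \<forall>i\<in>I. \<forall>R\<in>panels Ch adj i. \<exists>h\<in>carrier (G i). \<forall>C\<in>R. p (g C) i = act i h (p C i)}\<rparr>"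

definition Stab_Aut_sp ::
  "'i set \<Rightarrow> 'c set \<Rightarrow> ('i \<Rightarrow> 'c \<Rightarrow> 'c \<Rightarrow> bool) \<Rightarrow> ('c \<Rightarrow> 'i \<Rightarrow> 'e)
    \<Rightarrow> ('i \<Rightarrow> ('g, 'm) monoid_scheme) \<Rightarrow> ('i \<Rightarrow> 'g \<Rightarrow> 'e \<Rightarrow> 'e) \<Rightarrow> 'c \<Rightarrow> ('c \<Rightarrow> 'c) monoid"
where
  "Stab_Aut_sp I Ch adj p G act C0 =
     (Aut_sp I Ch adj p G act)\<lparr>carrier := stabilizer (Aut_sp I Ch adj p G act) (\<lambda>g. g) C0\<rparr>"

text \<open>Here \<open>D\<close> is one of the balls around \<open>C0\<close>; it contains \<open>C0\<close> unless its radius is \<open>0\<close>.\<close>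

definition Aut_sp_ball ::
  "'i set \<Rightarrow> 'c set \<Rightarrow> ('i \<Rightarrow> 'c \<Rightarrow> 'c \<Rightarrow> bool) \<Rightarrow> ('c \<Rightarrow> 'i \<Rightarrow> 'e)
    \<Rightarrow> ('i \<Rightarrow> ('g, 'm) monoid_scheme) \<Rightarrow> ('i \<Rightarrow> 'g \<Rightarrow> 'e \<Rightarrow> 'e) \<Rightarrow> 'c \<Rightarrow> 'c set \<Rightarrow> ('c \<Rightarrow> 'c) monoid"
where
  "Aut_sp_ball I Ch adj p G act C0 D =
     (BijGroup D)
       \<lparr>carrier := {g \<in> Bij D.
          (C0 \<in> D \<longrightarrow> g C0 = C0) \<and>
          (\<forall>i\<in>I. \<forall>A\<in>D. \<forall>B\<in>D. adj i (g A) (g B) \<longleftrightarrow> adj i A B) \<and>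
          (\<forall>i\<in>I. \<forall>R\<in>panels Ch adj i. R \<inter> D \<noteq> {} \<longrightarrow>
             (\<exists>h\<in>carrier (G i). \<forall>C\<in>R \<inter> D. p (g C) i = act i h (p C i)))}\<rparr>"

section \<open>Inverse limits\<close>

text \<open>The limit of \<open>H 0 \<leftarrow> H 1 \<leftarrow> H 2 \<leftarrow> \<dots>\<close> with bonding maps \<open>\<rho> n : H (n + 1) \<rightarrow> H n\<close>.\<close>

definition inverse_limit ::
  "(nat \<Rightarrow> ('a, 'm) monoid_scheme) \<Rightarrow> (nat \<Rightarrow> 'a \<Rightarrow> 'a) \<Rightarrow> (nat \<Rightarrow> 'a) monoid"
where
  "inverse_limit H \<rho> =
     (product_group UNIV H)
       \<lparr>carrier := {f \<in> carrier (product_group UNIV H). \<forall>n. \<rho> n (f (Suc n)) = f n}\<rparr>"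

end

theory Submission
  imports Defs
begin

text \<open>
  An automorphism is determined by its restrictions to the balls \<open>D n\<close>, since these exhaust the
  chambers, and the restrictions exist because an automorphism \<open>g\<close> fixing \<open>C0\<close> preserves each ball:
  \<open>g\<close> carries the galleries from \<open>C\<close> to \<open>C0\<close> to the galleries of the same types from \<open>g C\<close> to \<open>C0\<close>, so
  \<open>C\<close> and \<open>g C\<close> have the same Weyl distance to \<open>C0\<close> (\<open>weyl_dist_image\<close>). This gives an injective
  homomorphism from the stabilizer into the product of the groups of the balls.

  Conversely, a compatible family of maps on the balls glues to a bijection of all chambers, and
  adjacency passes to the glued map because any two chambers lie in a common ball. The one point that
  needs an argument is that the glued map is structure preserving: a family of group elements, one for
  each ball, is not enough, as a single element of \<open>G i\<close> has to serve a whole panel. But two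
  \<open>i\<close>-adjacent chambers have shortest galleries to \<open>C0\<close> whose lengths differ by at most one, so every
  panel, however large, is contained in one ball (\<open>panel_bounded\<close>), and the element for that ball
  serves the panel.

  So the image of the stabilizer in the product is exactly the set of compatible families
  (\<open>iso_inverse_limit_of_exhaustion\<close>). The argument speaks of chambers, adjacency and projections only,
  and is carried out in the locale \<open>chamber_structure\<close>. The geometry of \<open>\<U>(E, K')\<close> enters through two
  facts: \<open>i\<close>-adjacency amounts to equality of \<open>i\<close>-mirrors, so that panels are classes of an equivalence
  relation, and \<open>p\<close> maps chambers to chambers of \<open>E\<close> (\<open>gp_proj_mem\<close>), so that the group actions can be
  inverted and composed along \<open>p\<close>.
\<close>

section \<open>Galleries and the length of the Weyl distance\<close>

lemma gallery_imp_lists: "gallery I Ch adj A u B \<Longrightarrow> u \<in> lists I"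
  by (induction u arbitrary: A) auto

lemma word_length_weyl_dist_le:
  assumes "gallery I Ch adj C u C0"
  shows "word_length (weyl_dist I m Ch adj C C0) \<le> length u"
proof -
  have "\<exists>v. minimal_gallery I Ch adj C v C0"
    using ex_has_least_nat[of "\<lambda>v. gallery I Ch adj C v C0" u length] assms
    by (auto simp: minimal_gallery_def)
  then have "\<exists>w v. minimal_gallery I Ch adj C v C0 \<and> w = word_class I m v" by blast
  from someI_ex[OF this] obtain v where v: "minimal_gallery I Ch adj C v C0"
    "weyl_dist I m Ch adj C C0 = word_class I m v"
    unfolding weyl_dist_def by blast
  have "v \<in> lists I" using v(1) gallery_imp_lists[of I Ch adj C v C0]
    by (simp add: minimal_gallery_def)
  then have "v \<in> word_class I m v"
    by (simp add: word_class_def coxeter_rel_def coxeter_eq.refl)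
  then have "word_length (word_class I m v) \<le> length v"
    unfolding word_length_def by (intro Least_le) blast
  also have "\<dots> \<le> length u" using v(1) assms by (simp add: minimal_gallery_def)
  finally show ?thesis by (simp add: v(2))
qed

section \<open>Chamber structures and the automorphisms of their subsets\<close>

lemma Bij_imp_inj_on: "g \<in> Bij S \<Longrightarrow> inj_on g S"
  by (simp add: Bij_def bij_betw_def)

lemma Bij_imp_image: "g \<in> Bij S \<Longrightarrow> g ` S = S"
  by (simp add: Bij_def bij_betw_def)

text \<open>The relation whose classes are the \<open>i\<close>-panels.\<close>

definition panel_rel :: "'c set \<Rightarrow> ('i \<Rightarrow> 'c \<Rightarrow> 'c \<Rightarrow> bool) \<Rightarrow> 'i \<Rightarrow> ('c \<times> 'c) set" where
  "panel_rel Ch adj i = {(A, B). A \<in> Ch \<and> B \<in> Ch \<and> (A = B \<or> adj i A B)}"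

text \<open>
  Adjacency is irreflexive, so that a bijection preserves adjacency if and only if it preserves panels.
\<close>

locale chamber_structure =
  fixes I :: "'i set" and Ch :: "'c set" and adj :: "'i \<Rightarrow> 'c \<Rightarrow> 'c \<Rightarrow> bool"
    and p :: "'c \<Rightarrow> 'i \<Rightarrow> 'e" and Es :: "'i \<Rightarrow> 'e set"
    and G :: "'i \<Rightarrow> ('g, 'm) monoid_scheme" and act :: "'i \<Rightarrow> 'g \<Rightarrow> 'e \<Rightarrow> 'e"
  assumes equiv_panel_rel: "i \<in> I \<Longrightarrow> equiv Ch (panel_rel Ch adj i)"
    and adj_irrefl: "\<not> adj i A A"
    and proj_mem: "C \<in> Ch \<Longrightarrow> i \<in> I \<Longrightarrow> p C i \<in> Es i"
    and action: "i \<in> I \<Longrightarrow> group_action (G i) (Es i) (act i)"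
begin

lemma panels_eq: "panels Ch adj i = (\<lambda>A. panel_rel Ch adj i `` {A}) ` Ch"
  by (auto simp: panels_def quotient_def panel_rel_def)

lemma panel_rel_sym:
  "i \<in> I \<Longrightarrow> (A, B) \<in> panel_rel Ch adj i \<Longrightarrow> (B, A) \<in> panel_rel Ch adj i"
  using equiv_panel_rel[of i] by (meson equivE symD)

lemma adj_iff_panel_rel:
  "A \<in> Ch \<Longrightarrow> B \<in> Ch \<Longrightarrow> adj i A B \<longleftrightarrow> A \<noteq> B \<and> (A, B) \<in> panel_rel Ch adj i"
  using adj_irrefl by (auto simp: panel_rel_def)

text \<open>
  Naming a panel by any of its chambers turns the condition into one on pairs of chambers, which can be
  transported along a bijection without taking images of panels.
\<close>

definition structure_preserving_on :: "'c set \<Rightarrow> ('c \<Rightarrow> 'c) \<Rightarrow> bool" where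
  "structure_preserving_on D g \<longleftrightarrow> (\<forall>i\<in>I. \<forall>A\<in>D. \<exists>h\<in>carrier (G i). \<forall>C\<in>D.
     (A, C) \<in> panel_rel Ch adj i \<longrightarrow> p (g C) i = act i h (p C i))"

lemma structure_preserving_on_iff_panels:
  assumes "D \<subseteq> Ch"
  shows "structure_preserving_on D g \<longleftrightarrow> (\<forall>i\<in>I. \<forall>R\<in>panels Ch adj i. R \<inter> D \<noteq> {} \<longrightarrow>
     (\<exists>h\<in>carrier (G i). \<forall>C\<in>R \<inter> D. p (g C) i = act i h (p C i)))" (is "_ \<longleftrightarrow> ?P")
proof
  assume sp: "structure_preserving_on D g"
  show ?P
  proof (intro ballI impI)
    fix i R assume i: "i \<in> I" and R: "R \<in> panels Ch adj i" and ne: "R \<inter> D \<noteq> {}"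
    from ne obtain A where A: "A \<in> R" "A \<in> D" by blast
    have "R \<in> Ch // panel_rel Ch adj i" using R by (simp add: panels_def panel_rel_def)
    then have rel: "(A, C) \<in> panel_rel Ch adj i" if "C \<in> R" for C
      using quotient_eq_iff[OF equiv_panel_rel[OF i], of R R A C] that A by blast
    then show "\<exists>h\<in>carrier (G i). \<forall>C\<in>R \<inter> D. p (g C) i = act i h (p C i)"
      using sp i A unfolding structure_preserving_on_def by blast
  qed
next
  assume P: ?P
  show "structure_preserving_on D g"
    unfolding structure_preserving_on_def
  proof (intro ballI)
    fix i A assume i: "i \<in> I" and A: "A \<in> D"
    have "(A, A) \<in> panel_rel Ch adj i" using A assms by (auto simp: panel_rel_def)
    moreover have "panel_rel Ch adj i `` {A} \<in> panels Ch adj i"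
      using A assms by (auto simp: panels_eq)
    ultimately have "\<exists>h\<in>carrier (G i). \<forall>C\<in>panel_rel Ch adj i `` {A} \<inter> D. p (g C) i = act i h (p C i)"
      using P i A by blast
    then show "\<exists>h\<in>carrier (G i). \<forall>C\<in>D. (A, C) \<in> panel_rel Ch adj i \<longrightarrow> p (g C) i = act i h (p C i)"
      by blast
  qed
qed

lemma mem_Aut_sp_ball_iff:
  assumes "D \<subseteq> Ch"
  shows "g \<in> carrier (Aut_sp_ball I Ch adj p G act C0 D) \<longleftrightarrow>
    g \<in> Bij D \<and> (C0 \<in> D \<longrightarrow> g C0 = C0) \<and>
    (\<forall>i\<in>I. \<forall>A\<in>D. \<forall>B\<in>D. adj i (g A) (g B) \<longleftrightarrow> adj i A B) \<and> structure_preserving_on D g"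
  unfolding structure_preserving_on_iff_panels[OF assms] by (simp add: Aut_sp_ball_def)

lemma panel_rel_preserved:
  assumes "D \<subseteq> Ch" "g \<in> Bij D" "i \<in> I" "\<forall>A\<in>D. \<forall>B\<in>D. adj i (g A) (g B) \<longleftrightarrow> adj i A B"
    and "A \<in> D" "B \<in> D"
  shows "(g A, g B) \<in> panel_rel Ch adj i \<longleftrightarrow> (A, B) \<in> panel_rel Ch adj i"
proof -
  have "g A = g B \<longleftrightarrow> A = B" using Bij_imp_inj_on[OF assms(2)] assms(5,6) by (meson inj_onD)
  moreover have "g A \<in> D" "g B \<in> D" using Bij_imp_funcset[OF assms(2)] assms(5,6) by auto
  ultimately show ?thesis using assms by (auto simp: panel_rel_def)
qed

text \<open>
  On the panel of \<open>A\<close>, the inverse of \<open>g\<close> acts through the inverse of the element that serves \<open>g\<close> on the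
  panel of \<open>inv g A\<close>, and a composite \<open>g k\<close> through the product of the elements serving \<open>g\<close> on the panel of
  \<open>k A\<close> and \<open>k\<close> on the panel of \<open>A\<close>. The group laws hold along \<open>p\<close> because its values lie in the sets
  acted upon.
\<close>

lemma subgroup_Aut_sp_ball:
  assumes D: "D \<subseteq> Ch"
  shows "subgroup (carrier (Aut_sp_ball I Ch adj p G act C0 D)) (BijGroup D)" (is "subgroup ?H _")
proof -
  interpret B: group "BijGroup D" by (rule group_BijGroup)
  note mem = mem_Aut_sp_ball_iff[OF D]
  have car: "carrier (BijGroup D) = Bij D" by (simp add: BijGroup_def)
  show ?thesis
  proof (rule B.subgroupI)
    show "?H \<subseteq> carrier (BijGroup D)" by (auto simp: mem car)
    have "structure_preserving_on D (\<lambda>x\<in>D. x)"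
      unfolding structure_preserving_on_def
    proof (intro ballI)
      fix i A assume i: "i \<in> I"
      interpret group_action "G i" "Es i" "act i" by (rule action[OF i])
      have "\<one>\<^bsub>G i\<^esub> \<in> carrier (G i)"
        using group_hom group.is_monoid[of "G i"] by (simp add: group_hom_def monoid.one_closed)
      moreover have "p C i = act i \<one>\<^bsub>G i\<^esub> (p C i)" if "C \<in> D" for C
        using id_eq_one proj_mem[of C i] that D i by (metis restrict_apply' subsetD)
      ultimately show "\<exists>h\<in>carrier (G i). \<forall>C\<in>D. (A, C) \<in> panel_rel Ch adj i \<longrightarrow>
          p ((\<lambda>x\<in>D. x) C) i = act i h (p C i)"
        by auto
    qed
    then have "(\<lambda>x\<in>D. x) \<in> ?H" by (auto simp: mem id_Bij)
    then show "?H \<noteq> {}" by blast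
  next
    fix g assume g: "g \<in> ?H"
    then have gB: "g \<in> Bij D" and fix0: "C0 \<in> D \<Longrightarrow> g C0 = C0"
      and adj: "\<And>i. i \<in> I \<Longrightarrow> \<forall>A\<in>D. \<forall>B\<in>D. adj i (g A) (g B) \<longleftrightarrow> adj i A B"
      and sp: "structure_preserving_on D g"
      by (auto simp: mem)
    define k where "k = (\<lambda>x\<in>D. inv_into D g x)"
    have inv: "inv\<^bsub>BijGroup D\<^esub> g = k" unfolding k_def by (rule inv_BijGroup[OF gB])
    have kB: "k \<in> Bij D" unfolding k_def by (rule restrict_inv_into_Bij[OF gB])
    have kD: "k x \<in> D" if "x \<in> D" for x using Bij_imp_funcset[OF kB] that by auto
    have gk: "g (k x) = x" if "x \<in> D" for x
      using that Bij_imp_image[OF gB] by (simp add: k_def f_inv_into_f)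
    have k0: "k C0 = C0" if "C0 \<in> D"
      using gk[OF that] kD[OF that] fix0[OF that] Bij_imp_inj_on[OF gB] that by (metis inj_onD)
    have kadj: "\<forall>A\<in>D. \<forall>B\<in>D. adj i (k A) (k B) \<longleftrightarrow> adj i A B" if "i \<in> I" for i
      using adj[OF that] gk kD by metis
    have "structure_preserving_on D k"
      unfolding structure_preserving_on_def
    proof (intro ballI)
      fix i A assume i: "i \<in> I" and A: "A \<in> D"
      interpret group_action "G i" "Es i" "act i" by (rule action[OF i])
      obtain h where h: "h \<in> carrier (G i)"
        and hp: "\<And>C. C \<in> D \<Longrightarrow> (k A, C) \<in> panel_rel Ch adj i \<Longrightarrow> p (g C) i = act i h (p C i)"
        using sp i kD[OF A] unfolding structure_preserving_on_def by blast
      have "inv\<^bsub>G i\<^esub> h \<in> carrier (G i)"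
        using group_hom h by (simp add: group_hom_def group.inv_closed)
      moreover have "p (k C) i = act i (inv\<^bsub>G i\<^esub> h) (p C i)"
        if C: "C \<in> D" "(A, C) \<in> panel_rel Ch adj i" for C
      proof -
        have "(k A, k C) \<in> panel_rel Ch adj i"
          using panel_rel_preserved[OF D kB i kadj[OF i] A C(1)] C(2) by simp
        then have "p C i = act i h (p (k C) i)" using hp[OF kD[OF C(1)]] gk[OF C(1)] by simp
        moreover have "p (k C) i \<in> Es i" using proj_mem kD[OF C(1)] D i by blast
        ultimately show ?thesis using orbit_sym_aux[OF h] by metis
      qed
      ultimately show "\<exists>h\<in>carrier (G i). \<forall>C\<in>D. (A, C) \<in> panel_rel Ch adj i \<longrightarrow>
          p (k C) i = act i h (p C i)"
        by blast
    qed
    then show "inv\<^bsub>BijGroup D\<^esub> g \<in> ?H" using kB k0 kadj by (simp add: mem inv)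
  next
    fix g k assume g: "g \<in> ?H" and k: "k \<in> ?H"
    have gB: "g \<in> Bij D" and kB: "k \<in> Bij D" and spg: "structure_preserving_on D g"
      and spk: "structure_preserving_on D k"
      and kadj: "\<And>i. i \<in> I \<Longrightarrow> \<forall>A\<in>D. \<forall>B\<in>D. adj i (k A) (k B) \<longleftrightarrow> adj i A B"
      using g k by (auto simp: mem)
    have mult: "g \<otimes>\<^bsub>BijGroup D\<^esub> k = compose D g k" using gB kB by (simp add: BijGroup_def)
    have kD: "k x \<in> D" if "x \<in> D" for x using Bij_imp_funcset[OF kB] that by auto
    have "structure_preserving_on D (compose D g k)"
      unfolding structure_preserving_on_def
    proof (intro ballI)
      fix i A assume i: "i \<in> I" and A: "A \<in> D"
      interpret group_action "G i" "Es i" "act i" by (rule action[OF i])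
      obtain h where h: "h \<in> carrier (G i)"
        and hp: "\<And>C. C \<in> D \<Longrightarrow> (k A, C) \<in> panel_rel Ch adj i \<Longrightarrow> p (g C) i = act i h (p C i)"
        using spg i kD[OF A] unfolding structure_preserving_on_def by blast
      obtain h' where h': "h' \<in> carrier (G i)"
        and hp': "\<And>C. C \<in> D \<Longrightarrow> (A, C) \<in> panel_rel Ch adj i \<Longrightarrow> p (k C) i = act i h' (p C i)"
        using spk i A unfolding structure_preserving_on_def by blast
      have "h \<otimes>\<^bsub>G i\<^esub> h' \<in> carrier (G i)"
        using group_hom h h' by (simp add: group_hom_def group.is_monoid monoid.m_closed)
      moreover have "p (compose D g k C) i = act i (h \<otimes>\<^bsub>G i\<^esub> h') (p C i)"
        if C: "C \<in> D" "(A, C) \<in> panel_rel Ch adj i" for C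
      proof -
        have "(k A, k C) \<in> panel_rel Ch adj i"
          using panel_rel_preserved[OF D kB i kadj[OF i] A C(1)] C(2) by simp
        then have "p (g (k C)) i = act i h (act i h' (p C i))"
          using hp[OF kD[OF C(1)]] hp'[OF C] by simp
        moreover have "p C i \<in> Es i" using proj_mem C(1) D i by blast
        ultimately show ?thesis using composition_rule[OF _ h h'] C(1) by (simp add: compose_eq)
      qed
      ultimately show "\<exists>h\<in>carrier (G i). \<forall>C\<in>D. (A, C) \<in> panel_rel Ch adj i \<longrightarrow>
          p (compose D g k C) i = act i h (p C i)"
        by blast
    qed
    then show "g \<otimes>\<^bsub>BijGroup D\<^esub> k \<in> ?H"
      using g k kD by (simp add: mem mult compose_Bij compose_eq)
  qed
qed

lemma group_Aut_sp_ball: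
  "D \<subseteq> Ch \<Longrightarrow> group (Aut_sp_ball I Ch adj p G act C0 D)"
  using group.subgroup_imp_group[OF group_BijGroup subgroup_Aut_sp_ball, of D C0]
  by (simp add: Aut_sp_ball_def)

lemma mult_Aut_sp_ball:
  assumes "g \<in> carrier (Aut_sp_ball I Ch adj p G act C0 D)"
    and "k \<in> carrier (Aut_sp_ball I Ch adj p G act C0 D)"
  shows "g \<otimes>\<^bsub>Aut_sp_ball I Ch adj p G act C0 D\<^esub> k = compose D g k"
  using assms by (simp add: Aut_sp_ball_def BijGroup_def)

lemma image_panel:
  assumes "g \<in> Bij Ch" "i \<in> I" "\<forall>A\<in>Ch. \<forall>B\<in>Ch. adj i (g A) (g B) \<longleftrightarrow> adj i A B" "A \<in> Ch"
  shows "g ` (panel_rel Ch adj i `` {A}) = panel_rel Ch adj i `` {g A}"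
proof
  note rel = panel_rel_preserved[OF subset_refl assms(1-3)]
  have Ch: "B \<in> Ch" if "(A, B) \<in> panel_rel Ch adj i" for A B
    using that by (simp add: panel_rel_def)
  show "g ` (panel_rel Ch adj i `` {A}) \<subseteq> panel_rel Ch adj i `` {g A}"
    using rel[OF assms(4)] Ch by auto
  show "panel_rel Ch adj i `` {g A} \<subseteq> g ` (panel_rel Ch adj i `` {A})"
  proof
    fix B assume B: "B \<in> panel_rel Ch adj i `` {g A}"
    then obtain B' where "B' \<in> Ch" "B = g B'" using Ch Bij_imp_image[OF assms(1)] by blast
    then show "B \<in> g ` (panel_rel Ch adj i `` {A})" using B rel[OF assms(4)] by blast
  qed
qed

text \<open>
  Sending panels into panels in one direction is enough: the image of the panel of \<open>A\<close> is a whole panel,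
  hence the panel of \<open>g A\<close>, so membership in it is also reflected.
\<close>

lemma automorphism_iff_adj:
  "g \<in> automorphisms I Ch adj \<longleftrightarrow>
    g \<in> Bij Ch \<and> (\<forall>i\<in>I. \<forall>A\<in>Ch. \<forall>B\<in>Ch. adj i (g A) (g B) \<longleftrightarrow> adj i A B)"
    (is "_ \<longleftrightarrow> ?P")
proof
  assume g: "g \<in> automorphisms I Ch adj"
  then have gB: "g \<in> Bij Ch" by (simp add: automorphisms_def)
  have gCh: "g x \<in> Ch" if "x \<in> Ch" for x using Bij_imp_funcset[OF gB] that by auto
  note inj = Bij_imp_inj_on[OF gB]
  have "adj i (g A) (g B) \<longleftrightarrow> adj i A B" if i: "i \<in> I" and A: "A \<in> Ch" and B: "B \<in> Ch" for i A B
  proof -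
    let ?r = "panel_rel Ch adj i"
    have quot: "panels Ch adj i = Ch // ?r" by (simp add: panels_def panel_rel_def)
    have "?r `` {A} \<in> Ch // ?r" using A by (rule quotientI)
    then have "g ` (?r `` {A}) \<in> Ch // ?r"
      using g i quot by (auto simp: automorphisms_def)
    then obtain B' where B': "g ` (?r `` {A}) = ?r `` {B'}" by (rule quotientE)
    have "(A, A) \<in> ?r" using A by (simp add: panel_rel_def)
    then have "g A \<in> ?r `` {B'}" unfolding B'[symmetric] by blast
    then have "?r `` {B'} = ?r `` {g A}"
      using equiv_class_eq[OF equiv_panel_rel[OF i], of B' "g A"] by blast
    then have "g ` (?r `` {A}) = ?r `` {g A}" using B' by simp
    then have "(g A, g B) \<in> ?r \<longleftrightarrow> g B \<in> g ` (?r `` {A})" by auto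
    also have "\<dots> \<longleftrightarrow> (A, B) \<in> ?r"
      using inj_on_image_mem_iff[OF inj B, of "?r `` {A}"] by (auto simp: panel_rel_def)
    finally show ?thesis
      using inj_on_eq_iff[OF inj A B] adj_iff_panel_rel[OF A B] adj_iff_panel_rel[OF gCh[OF A] gCh[OF B]]
      by simp
  qed
  then show ?P using gB by blast
next
  assume P: ?P
  then have gCh: "g x \<in> Ch" if "x \<in> Ch" for x using Bij_imp_funcset[of g Ch] that by auto
  show "g \<in> automorphisms I Ch adj"
    using P gCh by (auto simp: automorphisms_def panels_eq image_panel)
qed

text \<open>
  The stabilizer is the group of the degenerate ball consisting of all chambers, so the facts about
  groups of balls apply to it.
\<close>

lemma Stab_Aut_sp_eq_ball:
  assumes "C0 \<in> Ch"
  shows "Stab_Aut_sp I Ch adj p G act C0 = Aut_sp_ball I Ch adj p G act C0 Ch"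
proof -
  have "R \<inter> Ch = R" "R \<noteq> {}" if "i \<in> I" "R \<in> panels Ch adj i" for i R
    using that by (auto simp: panels_eq panel_rel_def)
  then have "{g \<in> automorphisms I Ch adj. (\<forall>i\<in>I. \<forall>R\<in>panels Ch adj i.
       \<exists>h\<in>carrier (G i). \<forall>C\<in>R. p (g C) i = act i h (p C i))} =
     {g \<in> automorphisms I Ch adj. structure_preserving_on Ch g}"
    unfolding structure_preserving_on_iff_panels[OF subset_refl]
    by (intro Collect_cong conj_cong ball_cong) simp_all
  then have "carrier (Stab_Aut_sp I Ch adj p G act C0) = carrier (Aut_sp_ball I Ch adj p G act C0 Ch)"
    using assms unfolding set_eq_iff mem_Aut_sp_ball_iff[OF subset_refl]
    by (auto simp: Stab_Aut_sp_def Aut_sp_def stabilizer_def automorphism_iff_adj)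
  then show ?thesis by (simp add: Stab_Aut_sp_def Aut_sp_def Aut_sp_ball_def)
qed

section \<open>The inverse limit over an exhaustion\<close>

lemma restrict_mem_Aut_sp_ball:
  assumes g: "g \<in> carrier (Aut_sp_ball I Ch adj p G act C0 Ch)" and D: "D \<subseteq> Ch"
    and gD: "\<And>C. C \<in> Ch \<Longrightarrow> g C \<in> D \<longleftrightarrow> C \<in> D"
  shows "restrict g D \<in> carrier (Aut_sp_ball I Ch adj p G act C0 D)"
proof -
  have gB: "g \<in> Bij Ch" and sp: "structure_preserving_on Ch g" using g by (auto simp: mem_Aut_sp_ball_iff)
  have "g ` D = D"
  proof
    show "g ` D \<subseteq> D" using gD D by blast
    show "D \<subseteq> g ` D"
    proof
      fix B assume B: "B \<in> D"
      then obtain C where "C \<in> Ch" "B = g C" using D Bij_imp_image[OF gB] by blast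
      then show "B \<in> g ` D" using gD B by blast
    qed
  qed
  then have "bij_betw g D D" using inj_on_subset[OF Bij_imp_inj_on[OF gB] D] by (simp add: bij_betw_def)
  then have "restrict g D \<in> Bij D" by (simp add: Bij_def)
  moreover have "structure_preserving_on D (restrict g D)"
    using sp D unfolding structure_preserving_on_def by (fastforce simp: subset_iff)
  ultimately show ?thesis using g D by (auto simp: mem_Aut_sp_ball_iff subset_iff)
qed

text \<open>
  Since the image of the restriction map in the product is the carrier of the limit, the limit is a
  subgroup of the product as the image of a homomorphism. The hypothesis that each panel lies in one
  member of the exhaustion makes the map glued from a compatible family structure preserving.
\<close>

lemma iso_inverse_limit_of_exhaustion:
  assumes C0: "C0 \<in> Ch"
    and D: "\<And>n. D n \<subseteq> Ch" "\<And>n. D n \<subseteq> D (Suc n)" "(\<Union>n. D n) = Ch"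
    and panel: "\<And>i A. i \<in> I \<Longrightarrow> A \<in> Ch \<Longrightarrow> \<exists>n. panel_rel Ch adj i `` {A} \<subseteq> D n"
    and inv: "\<And>g n C. g \<in> carrier (Aut_sp_ball I Ch adj p G act C0 Ch) \<Longrightarrow> C \<in> Ch \<Longrightarrow>
      g C \<in> D n \<longleftrightarrow> C \<in> D n"
  defines "H \<equiv> \<lambda>n. Aut_sp_ball I Ch adj p G act C0 (D n)"
  shows "group (inverse_limit H (\<lambda>n g. restrict g (D n)))"
    and "(\<lambda>g n. restrict g (D n)) \<in>
      iso (Aut_sp_ball I Ch adj p G act C0 Ch) (inverse_limit H (\<lambda>n g. restrict g (D n)))"
proof -
  let ?S = "Aut_sp_ball I Ch adj p G act C0 Ch"
  let ?P = "product_group UNIV H"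
  let ?L = "inverse_limit H (\<lambda>n g. restrict g (D n))"
  define \<phi> where "\<phi> = (\<lambda>(g::'c \<Rightarrow> 'c) n. restrict g (D n))"
  have grpS: "group ?S" by (rule group_Aut_sp_ball) simp
  have grpP: "group ?P" unfolding H_def by (intro product_group group_Aut_sp_ball D)
  have memH: "g \<in> carrier (H n) \<longleftrightarrow> g \<in> Bij (D n) \<and> (C0 \<in> D n \<longrightarrow> g C0 = C0) \<and>
      (\<forall>i\<in>I. \<forall>A\<in>D n. \<forall>B\<in>D n. adj i (g A) (g B) \<longleftrightarrow> adj i A B) \<and> structure_preserving_on (D n) g" for g n
    unfolding H_def by (rule mem_Aut_sp_ball_iff[OF D(1)])
  note memS = mem_Aut_sp_ball_iff[OF subset_refl]
  have \<phi>H: "\<phi> g n \<in> carrier (H n)" if "g \<in> carrier ?S" for g n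
    unfolding \<phi>_def H_def using that D(1) inv by (intro restrict_mem_Aut_sp_ball) auto
  have hom: "\<phi> \<in> hom ?S ?P"
  proof (rule homI)
    show "\<phi> g \<in> carrier ?P" if "g \<in> carrier ?S" for g using \<phi>H[OF that] by auto
    show "\<phi> (g \<otimes>\<^bsub>?S\<^esub> k) = \<phi> g \<otimes>\<^bsub>?P\<^esub> \<phi> k" if g: "g \<in> carrier ?S" and k: "k \<in> carrier ?S" for g k
    proof
      fix n
      have "k C \<in> D n" if "C \<in> D n" for C using inv[OF k] that D(1) by blast
      then have "restrict (compose Ch g k) (D n) = compose (D n) (\<phi> g n) (\<phi> k n)"
        using D(1)[of n] by (auto simp: \<phi>_def compose_def fun_eq_iff)
      then show "\<phi> (g \<otimes>\<^bsub>?S\<^esub> k) n = (\<phi> g \<otimes>\<^bsub>?P\<^esub> \<phi> k) n"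
        using mult_Aut_sp_ball[OF g k]
          mult_Aut_sp_ball[OF \<phi>H[OF g, of n, unfolded H_def] \<phi>H[OF k, of n, unfolded H_def]]
        by (simp add: \<phi>_def H_def)
    qed
  qed
  have inj: "inj_on \<phi> (carrier ?S)"
  proof (rule inj_onI)
    fix g k assume g: "g \<in> carrier ?S" and k: "k \<in> carrier ?S" and eq: "\<phi> g = \<phi> k"
    have "g C = k C" if C: "C \<in> Ch" for C
    proof -
      obtain n where "C \<in> D n" using C D(3) by blast
      then show ?thesis using fun_cong[OF fun_cong[OF eq], of n C] by (simp add: \<phi>_def)
    qed
    then show "g = k"
      using g k by (intro extensionalityI[of g Ch k]) (auto simp: memS Bij_def)
  qed
  have img: "\<phi> ` carrier ?S = carrier ?L"
  proof
    show "\<phi> ` carrier ?S \<subseteq> carrier ?L"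
    proof
      fix f assume "f \<in> \<phi> ` carrier ?S"
      then obtain g where g: "g \<in> carrier ?S" "f = \<phi> g" by blast
      have "restrict (\<phi> g (Suc n)) (D n) = \<phi> g n" for n
        using D(2)[of n] by (auto simp: \<phi>_def fun_eq_iff)
      then show "f \<in> carrier ?L" using \<phi>H[OF g(1)] g(2) by (auto simp: inverse_limit_def)
    qed
    show "carrier ?L \<subseteq> \<phi> ` carrier ?S"
    proof
      fix f assume f: "f \<in> carrier ?L"
      then have fH: "f n \<in> carrier (H n)" and fS: "restrict (f (Suc n)) (D n) = f n" for n
        by (auto simp: inverse_limit_def)
      have mono: "D n \<subseteq> D m" if "n \<le> m" for n m using lift_Suc_mono_le[of D] D(2) that by blast
      have agree: "f m C = f n C" if "n \<le> m" "C \<in> D n" for n m C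
        using that
      proof (induction m rule: dec_induct)
        case (step m)
        then show ?case using fun_cong[OF fS[of m], of C] mono[of n m] by auto
      qed simp
      \<comment> \<open>The family is glued by using, at each chamber, the first member that contains the chamber.\<close>
      define lev where "lev C = (LEAST n. C \<in> D n)" for C
      define g where "g = (\<lambda>C\<in>Ch. f (lev C) C)"
      have gf: "g C = f n C" if "C \<in> D n" for C n
        using agree[of "lev C" n C] LeastI[of "\<lambda>n. C \<in> D n", OF that] Least_le[of "\<lambda>n. C \<in> D n", OF that]
          D(1) that by (auto simp: g_def lev_def)
      have common: "\<exists>n. A \<in> D n \<and> B \<in> D n" if AB: "A \<in> Ch" "B \<in> Ch" for A B
      proof -
        obtain a b where "A \<in> D a" "B \<in> D b" using AB D(3) by blast
        then show ?thesis using mono[of a "max a b"] mono[of b "max a b"] by auto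
      qed
      have fB: "f n \<in> Bij (D n)" for n using fH[of n] by (simp add: memH)
      have adj: "adj i (g A) (g B) \<longleftrightarrow> adj i A B" if AB: "A \<in> Ch" "B \<in> Ch" and i: "i \<in> I" for A B i
      proof -
        obtain n where n: "A \<in> D n" "B \<in> D n" using common[OF AB] by blast
        then show ?thesis using gf[OF n(1)] gf[OF n(2)] fH[of n] i by (simp add: memH)
      qed
      have "inj_on g Ch"
      proof (rule inj_onI)
        fix A B assume AB: "A \<in> Ch" "B \<in> Ch" and eq: "g A = g B"
        obtain n where n: "A \<in> D n" "B \<in> D n" using common[OF AB] by blast
        then show "A = B" using eq gf[OF n(1)] gf[OF n(2)] inj_onD[OF Bij_imp_inj_on[OF fB[of n]]] by auto
      qed
      moreover have "g ` Ch = Ch"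
      proof
        show "g ` Ch \<subseteq> Ch"
        proof
          fix B assume "B \<in> g ` Ch"
          then obtain C where C: "C \<in> Ch" "B = g C" by blast
          then obtain n where "C \<in> D n" using D(3) by blast
          then show "B \<in> Ch" using gf[of C n] C D(1)[of n] Bij_imp_image[OF fB[of n]] by auto
        qed
        show "Ch \<subseteq> g ` Ch"
        proof
          fix B assume "B \<in> Ch"
          then obtain n where "B \<in> D n" using D(3) by blast
          then obtain C where C: "C \<in> D n" "B = f n C" using Bij_imp_image[OF fB[of n]] by blast
          then have "B = g C" "C \<in> Ch" using gf[OF C(1)] D(1)[of n] by auto
          then show "B \<in> g ` Ch" by blast
        qed
      qed
      ultimately have "g \<in> Bij Ch" by (simp add: Bij_def bij_betw_def g_def)
      moreover have "g C0 = C0"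
      proof -
        obtain n where "C0 \<in> D n" using C0 D(3) by blast
        then show ?thesis using gf[of C0 n] fH[of n] by (simp add: memH)
      qed
      moreover have "structure_preserving_on Ch g"
        unfolding structure_preserving_on_def
      proof (intro ballI)
        fix i A assume i: "i \<in> I" and A: "A \<in> Ch"
        obtain n where n: "panel_rel Ch adj i `` {A} \<subseteq> D n" using panel[OF i A] by blast
        moreover have "(A, A) \<in> panel_rel Ch adj i" using A by (simp add: panel_rel_def)
        ultimately have "A \<in> D n" by blast
        then obtain h where "h \<in> carrier (G i)"
          "\<And>C. C \<in> D n \<Longrightarrow> (A, C) \<in> panel_rel Ch adj i \<Longrightarrow> p (f n C) i = act i h (p C i)"
          using fH[of n] i unfolding memH structure_preserving_on_def by blast
        then show "\<exists>h\<in>carrier (G i). \<forall>C\<in>Ch. (A, C) \<in> panel_rel Ch adj i \<longrightarrow> p (g C) i = act i h (p C i)"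
          using n gf by (intro bexI[of _ h]) auto
      qed
      ultimately have "g \<in> carrier ?S" using adj by (simp add: memS)
      moreover have "\<phi> g = f"
      proof (intro ext)
        fix n C
        show "\<phi> g n C = f n C"
          using gf[of C n] fB[of n] by (cases "C \<in> D n") (auto simp: \<phi>_def Bij_def extensional_def)
      qed
      ultimately show "f \<in> \<phi> ` carrier ?S" by blast
    qed
  qed
  have L: "?L = ?P\<lparr>carrier := carrier ?L\<rparr>" by (simp add: inverse_limit_def)
  interpret gh: group_hom ?S ?P \<phi>
    using grpS grpP hom by (simp add: group_hom_def group_hom_axioms_def)
  have "subgroup (carrier ?L) ?P" using gh.img_is_subgroup by (simp only: img)
  then show "group ?L" using group.subgroup_imp_group[OF grpP] by (subst L)
  have "\<phi> \<in> hom ?S ?L"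
    using hom img by (subst L) (auto simp: hom_def)
  then show "(\<lambda>g n. restrict g (D n)) \<in> iso ?S ?L"
    using inj img by (simp add: iso_def bij_betw_def \<phi>_def)
qed

section \<open>Balls around a chamber\<close>

lemma gallery_image_iff:
  assumes g: "g \<in> Bij Ch" and adj: "\<forall>i\<in>I. \<forall>A\<in>Ch. \<forall>B\<in>Ch. adj i (g A) (g B) \<longleftrightarrow> adj i A B"
    and "A \<in> Ch" "B \<in> Ch"
  shows "gallery I Ch adj (g A) u (g B) \<longleftrightarrow> gallery I Ch adj A u B"
  using assms(3)
proof (induction u arbitrary: A)
  case Nil
  then show ?case
    using inj_on_eq_iff[OF Bij_imp_inj_on[OF g], of A B] assms(4) Bij_imp_funcset[OF g] by auto
next
  case (Cons i u)
  have "(\<exists>B'\<in>g ` Ch. adj i (g A) B' \<and> gallery I Ch adj B' u (g B)) \<longleftrightarrow>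
      (\<exists>B'\<in>Ch. adj i (g A) (g B') \<and> gallery I Ch adj (g B') u (g B))"
    by blast
  then have "(\<exists>B'\<in>Ch. adj i (g A) B' \<and> gallery I Ch adj B' u (g B)) \<longleftrightarrow>
      (\<exists>B'\<in>Ch. adj i (g A) (g B') \<and> gallery I Ch adj (g B') u (g B))"
    unfolding Bij_imp_image[OF g] .
  moreover have "g A \<in> Ch" using Bij_imp_funcset[OF g] Cons.prems by auto
  ultimately show ?case using Cons adj by (cases "i \<in> I") auto
qed

text \<open>
  \<open>C\<close> and \<open>g C\<close> are joined to \<open>C0\<close> by galleries of the same types, and the Weyl distance is chosen from
  the set of these types alone.
\<close>

lemma weyl_dist_image:
  assumes g: "g \<in> carrier (Aut_sp_ball I Ch adj p G act C0 Ch)" and C: "C \<in> Ch" "C0 \<in> Ch"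
  shows "weyl_dist I m Ch adj (g C) C0 = weyl_dist I m Ch adj C C0"
proof -
  have "gallery I Ch adj (g C) u C0 \<longleftrightarrow> gallery I Ch adj C u C0" for u
    using gallery_image_iff[of g C C0 u] g C by (simp add: mem_Aut_sp_ball_iff)
  then show ?thesis by (simp add: weyl_dist_def minimal_gallery_def)
qed

text \<open>
  Passing first to \<open>A\<close> along the panel, and then following a gallery of type \<open>u\<close> from \<open>A\<close> to \<open>C0\<close>, joins
  every other chamber of the panel of \<open>A\<close> to \<open>C0\<close> by a gallery of type \<open>i # u\<close>.
\<close>

lemma panel_bounded:
  assumes i: "i \<in> I" and A: "A \<in> Ch"
  shows "\<exists>n. \<forall>C\<in>panel_rel Ch adj i `` {A}. word_length (weyl_dist I m Ch adj C C0) < n"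
proof (cases "\<exists>u. gallery I Ch adj A u C0")
  case True
  then obtain u where u: "gallery I Ch adj A u C0" by blast
  have "word_length (weyl_dist I m Ch adj C C0) < Suc (Suc (length u))"
    if C: "(A, C) \<in> panel_rel Ch adj i" for C
  proof (cases "C = A")
    case True
    then show ?thesis using word_length_weyl_dist_le[OF u, of m] by simp
  next
    case False
    have "(C, A) \<in> panel_rel Ch adj i" using panel_rel_sym[OF i C] .
    then have "gallery I Ch adj C (i # u) C0"
      using False u i by (auto simp: panel_rel_def)
    from word_length_weyl_dist_le[OF this, of m] show ?thesis by simp
  qed
  then show ?thesis by blast
next
  case False
  \<comment> \<open>If no gallery leads from \<open>A\<close> to \<open>C0\<close>, none does from any other chamber of the panel, and then
    \<open>weyl_dist\<close> has one and the same default value for all of them.\<close>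
  have "\<not> gallery I Ch adj C u C0" if C: "(A, C) \<in> panel_rel Ch adj i" for C u
  proof
    assume "gallery I Ch adj C u C0"
    then have "C = A \<or> gallery I Ch adj A (i # u) C0" using C i by (auto simp: panel_rel_def)
    then show False using False \<open>gallery I Ch adj C u C0\<close> by blast
  qed
  then have "weyl_dist I m Ch adj C C0 = (SOME w. False)" if "(A, C) \<in> panel_rel Ch adj i" for C
    using that by (simp add: weyl_dist_def minimal_gallery_def)
  then show ?thesis by (intro exI[of _ "Suc (word_length (SOME w. False))"]) auto
qed

end

section \<open>The projection of a graph product\<close>

lemma U_point_eq_iff:
  assumes "finite I" "C \<in> prod_chambers I Es" "C' \<in> prod_chambers I Es"
    and "x \<in> davis_chamber I Edges" "y \<in> davis_chamber I Edges"
  shows "U_point I Edges Es C x = U_point I Edges Es C' y \<longleftrightarrow>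
    x = y \<and> (\<forall>i\<in>I. x \<notin> davis_mirror I Edges i \<longrightarrow> C i = C' i)"
proof -
  have "U_point I Edges Es C x = U_point I Edges Es C' y \<longleftrightarrow> ((C, x), (C', y)) \<in> U_rel I Edges Es"
    unfolding U_point_def using assms by (intro eq_equiv_class_iff[OF equiv_U_rel]) auto
  also have "\<dots> \<longleftrightarrow> x = y \<and> (\<forall>i\<in>I. x \<notin> davis_mirror I Edges i \<longrightarrow> C i = C' i)"
    using assms prod_dist_in_generate_iff[OF assms(1), of "{i \<in> I. x \<in> davis_mirror I Edges i}" C C']
    by (auto simp: U_rel_def)
  finally show ?thesis .
qed

text \<open>The vertex \<open>{}\<close> of the Davis chamber, in barycentric coordinates, lies on no mirror.\<close>

lemma empty_vertex_Davis_chamber: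
  "(\<lambda>T. if T = {} then 1 else 0) \<in> davis_chamber I Edges"
  "(\<lambda>T. if T = {} then 1 else 0) \<notin> davis_mirror I Edges i"
proof -
  interpret W: group "racg I Edges"
    by (rule group_coxeter_group) (simp add: right_angled_matrix_def)
  have "{} \<in> spherical_subsets I Edges"
    using W.generate_empty by (simp add: spherical_subsets_def)
  moreover have supp: "{T. (if T = {} then 1 else (0::real)) \<noteq> 0} = {{}}" by auto
  ultimately show "(\<lambda>T. if T = {} then 1 else 0) \<in> davis_chamber I Edges"
    by (simp add: davis_chamber_def realization_def)
  show "(\<lambda>T. if T = {} then 1 else 0) \<notin> davis_mirror I Edges i"
    by (auto simp: davis_mirror_def realization_def)
qed

text \<open>
  The point of a copy of the Davis chamber at its vertex \<open>{}\<close> is identified with no point of another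
  copy, because gluing happens along mirrors only.
\<close>

lemma U_point_image_inj:
  assumes "finite I" "C \<in> prod_chambers I Es" "C' \<in> prod_chambers I Es"
    and "U_point I Edges Es C ` davis_chamber I Edges = U_point I Edges Es C' ` davis_chamber I Edges"
  shows "C = C'"
proof -
  let ?o = "\<lambda>T::'a set. if T = {} then 1 else (0::real)"
  have o: "?o \<in> davis_chamber I Edges" by (rule empty_vertex_Davis_chamber)
  then obtain y where y: "y \<in> davis_chamber I Edges" "U_point I Edges Es C ?o = U_point I Edges Es C' y"
    using assms(4) by blast
  have "C i = C' i" if "i \<in> I" for i
    using U_point_eq_iff[OF assms(1-3) o y(1)] y(2) that empty_vertex_Davis_chamber(2)[of I Edges i]
    by blast
  then show ?thesis using assms(2,3) by (intro PiE_ext)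
qed

lemma gp_proj_mem:
  assumes "finite I" "A \<in> gp_chambers I Edges Es X q"
  shows "gp_proj I Edges Es q A \<in> prod_chambers I Es"
proof -
  from assms(2) obtain C where C: "C \<in> prod_chambers I Es"
    "q ` A = U_point I Edges Es C ` davis_chamber I Edges"
    by (auto simp: gp_chambers_def image_image)
  have "gp_proj I Edges Es q A = C"
    unfolding gp_proj_def
  proof (rule the_equality)
    show "C' = C" if "C' \<in> prod_chambers I Es \<and>
        q ` A = U_point I Edges Es C' ` davis_chamber I Edges" for C'
      using U_point_image_inj[OF assms(1), of C' Es C Edges] that C by simp
  qed (use C in blast)
  then show ?thesis using C(1) by simp
qed

text \<open>Panels are the classes of chambers with equal mirrors.\<close>

lemma chamber_structure_graph_product:
  assumes "finite I" "\<And>i. i \<in> I \<Longrightarrow> group_action (G i) (Es i) (act i)"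
  shows "chamber_structure I (gp_chambers I Edges Es X q) (gp_adj I Edges Es q)
    (gp_proj I Edges Es q) Es G act"
proof (rule chamber_structure.intro)
  fix i
  show "equiv (gp_chambers I Edges Es X q) (panel_rel (gp_chambers I Edges Es X q) (gp_adj I Edges Es q) i)"
  proof (intro equivI)
    show "panel_rel (gp_chambers I Edges Es X q) (gp_adj I Edges Es q) i
        \<subseteq> gp_chambers I Edges Es X q \<times> gp_chambers I Edges Es X q"
      unfolding panel_rel_def by blast
    show "refl_on (gp_chambers I Edges Es X q) (panel_rel (gp_chambers I Edges Es X q) (gp_adj I Edges Es q) i)"
      unfolding panel_rel_def refl_on_def by blast
    show "sym (panel_rel (gp_chambers I Edges Es X q) (gp_adj I Edges Es q) i)"
      unfolding panel_rel_def sym_def gp_adj_def by force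
    show "trans (panel_rel (gp_chambers I Edges Es X q) (gp_adj I Edges Es q) i)"
      unfolding panel_rel_def trans_def gp_adj_def by force
  qed
  show "\<not> gp_adj I Edges Es q i A A" for A by (simp add: gp_adj_def)
  show "gp_proj I Edges Es q C i \<in> Es i" if "C \<in> gp_chambers I Edges Es X q" "i \<in> I" for C
    using PiE_mem[OF gp_proj_mem[OF assms(1) that(1)] that(2)] .
qed (rule assms(2))

theorem theorem9p3:
  fixes I :: "'i set" and Edges :: "'i set set" and Es :: "'i \<Rightarrow> 'e set"
    and G :: "'i \<Rightarrow> ('g, 'm) monoid_scheme" and act :: "'i \<Rightarrow> 'g \<Rightarrow> 'e \<Rightarrow> 'e"
    and X :: "'x topology" and q :: "'x \<Rightarrow> (('i \<Rightarrow> 'e) \<times> ('i set \<Rightarrow> real)) set"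
    and Ch :: "'x set set" and adj :: "'i \<Rightarrow> 'x set \<Rightarrow> 'x set \<Rightarrow> bool"
    and p :: "'x set \<Rightarrow> 'i \<Rightarrow> 'e" and C0 :: "'x set" and D :: "nat \<Rightarrow> 'x set set"
  assumes "finite I" and "simplicial_graph I Edges"
    and "\<And>i. i \<in> I \<Longrightarrow> rank_one_building (Es i)"
    and "\<And>i. i \<in> I \<Longrightarrow> group_action (G i) (Es i) (act i)"
    and "universal_cover X q (U_space I Edges Es)"
    and "Ch = gp_chambers I Edges Es X q"
    and "adj = gp_adj I Edges Es q"
    and "p = gp_proj I Edges Es q"
    and "C0 \<in> Ch"
    and "\<And>n. D n = {C \<in> Ch. word_length (weyl_dist I (right_angled_matrix Edges) Ch adj C C0) < n}"
  shows "group (Stab_Aut_sp I Ch adj p G act C0) \<and>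
    group (inverse_limit (\<lambda>n. Aut_sp_ball I Ch adj p G act C0 (D n)) (\<lambda>n g. restrict g (D n))) \<and>
    (\<lambda>g n. restrict g (D n)) \<in>
      iso (Stab_Aut_sp I Ch adj p G act C0)
          (inverse_limit (\<lambda>n. Aut_sp_ball I Ch adj p G act C0 (D n)) (\<lambda>n g. restrict g (D n)))"
proof -
  interpret chamber_structure I Ch adj p Es G act
    unfolding assms(6-8) using assms(1,4) by (rule chamber_structure_graph_product)
  have balls: "D n \<subseteq> Ch" "D n \<subseteq> D (Suc n)" for n
    unfolding assms(10) by auto
  have exhaust: "(\<Union>n. D n) = Ch"
    unfolding assms(10) by auto
  have panel: "\<exists>n. panel_rel Ch adj i `` {A} \<subseteq> D n" if "i \<in> I" "A \<in> Ch" for i A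
    using panel_bounded[OF that, of "right_angled_matrix Edges" C0] unfolding assms(10)
    by (auto simp: panel_rel_def)
  have inv: "g C \<in> D n \<longleftrightarrow> C \<in> D n"
    if g: "g \<in> carrier (Aut_sp_ball I Ch adj p G act C0 Ch)" and C: "C \<in> Ch" for g n C
  proof -
    have "g C \<in> Ch" using g C Bij_imp_funcset[of g Ch] by (auto simp: mem_Aut_sp_ball_iff)
    then show ?thesis using weyl_dist_image[OF g C assms(9)] C by (simp add: assms(10))
  qed
  show ?thesis
    unfolding Stab_Aut_sp_eq_ball[OF assms(9)]
    using assms(9) balls exhaust panel inv
    by (intro conjI group_Aut_sp_ball[OF subset_refl] iso_inverse_limit_of_exhaustion)
qed

end
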